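(* Let $R$ be a commutative Krasner hyperring with nonzero identity, let $\phi$ be a hyperideal reduction and $\delta$ a hyperideal expansion. Then: (i) every $\phi$-$\delta$-pure hyperideal of $R$ is a $\phi$-$\delta$-$r$-hyperideal; (ii) every $\phi$-$\delta$-von Neumann regular hyperideal of $R$ is a $\phi$-$\delta$-$r$-hyperideal.
   Context: A Krasner hyperring $(R,+,\cdot)$ is a set where $(R,+)$ is a canonical hypergroup (a commutative, associative hyperoperation with values nonempty subsets, an element $0$ with $x+0=\{x\}$, unique opposites $-x$ with $0\in x+(-x)$, and $z\in x+y$ implies $y\in -x+z$ and $x\in z-y$), $(R,\cdot)$ is a semigroup (single-valued multiplication) with $0$ bilaterally absorbing, and $\cdot$ is distributive over $+$. It is commutative with nonzero identity if $\cdot$ is commutative with an identity $1\neq 0$. A hyperideal is a nonempty $N\subseteq R$ with $x-y\subseteq N$ and $rx\in N$ for all $x,y\in N$, $r\in R$. For $a\in R$, $ann(a)=\{r\in R: ra=0\}$, and "$ann(a)=0$" means $ann(a)=\{0\}$. A hyperideal expansion is a function $\delta$ assigning to each hyperideal $N$ a hyperideal $\delta(N)$ of the same hyperring such that $N\subseteq\delta(N)$, and $N\subseteq M$ implies $\delta(N)\subseteq\delta(M)$. A hyperideal reduction is a function $\phi$ assigning to each hyperideal $N$ a hyperideal $\phi(N)$ of the same hyperring such that $\phi(N)\subseteq N$, and $N\subseteq M$ implies $\phi(N)\subseteq\phi(M)$. A proper hyperideal $N$ of $R$ is: a $\phi$-$\delta$-$r$-hyperideal if for all $a,b\in R$, $a\cdot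 b\in N\setminus\phi(N)$ and $ann(a)=0$ imply $b\in\delta(N)$; $\phi$-$\delta$-pure if for every $a\in N\setminus\phi(N)$ there is $b\in\delta(N)$ with $a=a\cdot b$; $\phi$-$\delta$-von Neumann regular if for every $a\in N\setminus\phi(N)$ there is $b\in\delta(N)$ with $a=a^2\cdot b$. *)

theory Defs
  imports "HOL-Algebra.Group"
begin

record 'a hyperring = "'a monoid" +
  hzero :: 'a  ("\<zero>\<index>")
  hadd :: "'a \<Rightarrow> 'a \<Rightarrow> 'a set"  (infixl "\<boxplus>\<index>" 65)

definition opp :: "('a, 'm) hyperring_scheme \<Rightarrow> 'a \<Rightarrow> 'a"  ("\<boxminus>\<index> _" [81] 80) where
  "\<boxminus>\<^bsub>R\<^esub> x = (THE y. y \<in> carrier R \<and> \<zero>\<^bsub>R\<^esub> \<in> x \<boxplus>\<^bsub>R\<^esub> y)"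

definition hdiff :: "('a, 'm) hyperring_scheme \<Rightarrow> 'a \<Rightarrow> 'a \<Rightarrow> 'a set"  (infixl "\<boxminus>\<boxminus>\<index>" 65) where
  "x \<boxminus>\<boxminus>\<^bsub>R\<^esub> y = x \<boxplus>\<^bsub>R\<^esub> (\<boxminus>\<^bsub>R\<^esub> y)"

locale canonical_hypergroup =
  fixes R (structure)
  assumes hadd_subset: "\<lbrakk>x \<in> carrier R; y \<in> carrier R\<rbrakk> \<Longrightarrow> x \<boxplus> y \<subseteq> carrier R"
    and hadd_nonempty: "\<lbrakk>x \<in> carrier R; y \<in> carrier R\<rbrakk> \<Longrightarrow> x \<boxplus> y \<noteq> {}"
    and hadd_commute: "\<lbrakk>x \<in> carrier R; y \<in> carrier R\<rbrakk> \<Longrightarrow> x \<boxplus> y = y \<boxplus> x"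
    and hadd_assoc: "\<lbrakk>x \<in> carrier R; y \<in> carrier R; z \<in> carrier R\<rbrakk>
      \<Longrightarrow> (\<Union>u\<in>x \<boxplus> y. u \<boxplus> z) = (\<Union>v\<in>y \<boxplus> z. x \<boxplus> v)"
    and hzero_closed: "\<zero> \<in> carrier R"
    and hadd_hzero: "x \<in> carrier R \<Longrightarrow> x \<boxplus> \<zero> = {x}"
    and ex1_opp: "x \<in> carrier R \<Longrightarrow> \<exists>!y. y \<in> carrier R \<and> \<zero> \<in> x \<boxplus> y"
    and reversible: "\<lbrakk>x \<in> carrier R; y \<in> carrier R; z \<in> x \<boxplus> y\<rbrakk>
      \<Longrightarrow> y \<in> (\<boxminus> x) \<boxplus> z \<and> x \<in> z \<boxminus>\<boxminus> y"

locale krasner_hyperring = canonical_hypergroup R for R (structure) +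
  assumes mult_closed: "\<lbrakk>x \<in> carrier R; y \<in> carrier R\<rbrakk> \<Longrightarrow> x \<otimes> y \<in> carrier R"
    and mult_assoc: "\<lbrakk>x \<in> carrier R; y \<in> carrier R; z \<in> carrier R\<rbrakk>
      \<Longrightarrow> (x \<otimes> y) \<otimes> z = x \<otimes> (y \<otimes> z)"
    and l_absorb: "x \<in> carrier R \<Longrightarrow> \<zero> \<otimes> x = \<zero>"
    and r_absorb: "x \<in> carrier R \<Longrightarrow> x \<otimes> \<zero> = \<zero>"
    and l_distrib: "\<lbrakk>x \<in> carrier R; y \<in> carrier R; z \<in> carrier R\<rbrakk>
      \<Longrightarrow> (\<lambda>t. z \<otimes> t) ` (x \<boxplus> y) = (z \<otimes> x) \<boxplus> (z \<otimes> y)"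
    and r_distrib: "\<lbrakk>x \<in> carrier R; y \<in> carrier R; z \<in> carrier R\<rbrakk>
      \<Longrightarrow> (\<lambda>t. t \<otimes> z) ` (x \<boxplus> y) = (x \<otimes> z) \<boxplus> (y \<otimes> z)"

locale comm_krasner_hyperring_1 = krasner_hyperring R + comm_monoid R for R (structure) +
  assumes one_neq_hzero: "\<one> \<noteq> \<zero>"

definition hyperideal :: "('a, 'm) hyperring_scheme \<Rightarrow> 'a set \<Rightarrow> bool" where
  "hyperideal R N \<longleftrightarrow> N \<subseteq> carrier R \<and> N \<noteq> {}
     \<and> (\<forall>x\<in>N. \<forall>y\<in>N. x \<boxminus>\<boxminus>\<^bsub>R\<^esub> y \<subseteq> N)
     \<and> (\<forall>r\<in>carrier R. \<forall>x\<in>N. r \<otimes>\<^bsub>R\<^esub> x \<in> N)"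

definition proper_hyperideal :: "('a, 'm) hyperring_scheme \<Rightarrow> 'a set \<Rightarrow> bool" where
  "proper_hyperideal R N \<longleftrightarrow> hyperideal R N \<and> N \<noteq> carrier R"

definition ann :: "('a, 'm) hyperring_scheme \<Rightarrow> 'a \<Rightarrow> 'a set" where
  "ann R a = {r \<in> carrier R. r \<otimes>\<^bsub>R\<^esub> a = \<zero>\<^bsub>R\<^esub>}"

text \<open>Expansions and reductions are functions on the hyperideals of \<open>R\<close>; they are modelled by
  functions on all sets, whose values on sets other than hyperideals are unconstrained.\<close>

definition hyperideal_expansion ::
  "('a, 'm) hyperring_scheme \<Rightarrow> ('a set \<Rightarrow> 'a set) \<Rightarrow> bool" where
  "hyperideal_expansion R \<delta> \<longleftrightarrow>
     (\<forall>N. hyperideal R N \<longrightarrow> hyperideal R (\<delta> N) \<and> N \<subseteq> \<delta> N)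
     \<and> (\<forall>N M. hyperideal R N \<and> hyperideal R M \<and> N \<subseteq> M \<longrightarrow> \<delta> N \<subseteq> \<delta> M)"

definition hyperideal_reduction ::
  "('a, 'm) hyperring_scheme \<Rightarrow> ('a set \<Rightarrow> 'a set) \<Rightarrow> bool" where
  "hyperideal_reduction R \<phi> \<longleftrightarrow>
     (\<forall>N. hyperideal R N \<longrightarrow> hyperideal R (\<phi> N) \<and> \<phi> N \<subseteq> N)
     \<and> (\<forall>N M. hyperideal R N \<and> hyperideal R M \<and> N \<subseteq> M \<longrightarrow> \<phi> N \<subseteq> \<phi> M)"

definition phi_delta_r_hyperideal ::
  "('a, 'm) hyperring_scheme \<Rightarrow> ('a set \<Rightarrow> 'a set) \<Rightarrow> ('a set \<Rightarrow> 'a set) \<Rightarrow> 'a set \<Rightarrow> bool" where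
  "phi_delta_r_hyperideal R \<phi> \<delta> N \<longleftrightarrow> proper_hyperideal R N
     \<and> (\<forall>a\<in>carrier R. \<forall>b\<in>carrier R.
          a \<otimes>\<^bsub>R\<^esub> b \<in> N - \<phi> N \<and> ann R a = {\<zero>\<^bsub>R\<^esub>} \<longrightarrow> b \<in> \<delta> N)"

definition phi_delta_pure_hyperideal ::
  "('a, 'm) hyperring_scheme \<Rightarrow> ('a set \<Rightarrow> 'a set) \<Rightarrow> ('a set \<Rightarrow> 'a set) \<Rightarrow> 'a set \<Rightarrow> bool" where
  "phi_delta_pure_hyperideal R \<phi> \<delta> N \<longleftrightarrow> proper_hyperideal R N
     \<and> (\<forall>a\<in>N - \<phi> N. \<exists>b\<in>\<delta> N. a = a \<otimes>\<^bsub>R\<^esub> b)"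

definition phi_delta_von_neumann_regular_hyperideal ::
  "('a, 'm) hyperring_scheme \<Rightarrow> ('a set \<Rightarrow> 'a set) \<Rightarrow> ('a set \<Rightarrow> 'a set) \<Rightarrow> 'a set \<Rightarrow> bool" where
  "phi_delta_von_neumann_regular_hyperideal R \<phi> \<delta> N \<longleftrightarrow> proper_hyperideal R N
     \<and> (\<forall>a\<in>N - \<phi> N. \<exists>b\<in>\<delta> N. a = a [^]\<^bsub>R\<^esub> (2::nat) \<otimes>\<^bsub>R\<^esub> b)"

end

theory Submission
  imports Defs
begin

text \<open>
  The key is cancellation: an element \<open>a\<close> whose annihilator is zero can be cancelled from
  \<open>a \<otimes> b = a \<otimes> c\<close>, even though addition is multivalued (lemma \<open>mult_left_cancel\<close>). If now \<open>N\<close>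
  is pure and \<open>a \<otimes> b \<in> N - \<phi> N\<close>, purity gives \<open>a \<otimes> b = (a \<otimes> b) \<otimes> x = a \<otimes> (b \<otimes> x)\<close> with
  \<open>x \<in> \<delta> N\<close>, so \<open>b = b \<otimes> x\<close>, which lies in \<open>\<delta> N\<close> because \<open>\<delta> N\<close> absorbs multiplication.
  A von Neumann regular hyperideal is pure, since \<open>a = a\<^sup>2 \<otimes> b\<close> can be read as
  \<open>a = a \<otimes> (a \<otimes> b)\<close> with \<open>a \<otimes> b \<in> \<delta> N\<close>.
\<close>

text \<open>
  The difference of \<open>b\<close> and \<open>c\<close> is only a set, so \<open>a \<otimes> (b - c) = 0\<close> is not available.
  Distributivity still puts \<open>\<zero>\<close> into the image of that set under multiplication by \<open>a\<close>;
  the vanishing annihilator turns this into \<open>\<zero>\<close> being in the set itself, and uniqueness of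
  opposites finishes.
\<close>

lemma (in comm_krasner_hyperring_1) mult_left_cancel:
  assumes a: "a \<in> carrier R" and b: "b \<in> carrier R" and c: "c \<in> carrier R"
    and ann: "ann R a = {\<zero>}" and eq: "a \<otimes> b = a \<otimes> c"
  shows "b = c"
proof -
  obtain d where d: "d \<in> carrier R" "\<zero> \<in> c \<boxplus> d"
    using ex1_opp[OF c] by blast
  have "a \<otimes> \<zero> \<in> (\<lambda>t. a \<otimes> t) ` (c \<boxplus> d)"
    using d by blast
  hence "\<zero> \<in> (a \<otimes> c) \<boxplus> (a \<otimes> d)"
    by (simp add: l_distrib[OF c d(1) a] r_absorb[OF a])
  hence "\<zero> \<in> (\<lambda>t. a \<otimes> t) ` (b \<boxplus> d)"
    by (simp add: l_distrib[OF b d(1) a] eq)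
  then obtain t where t: "t \<in> b \<boxplus> d" "a \<otimes> t = \<zero>"
    by auto
  have "t \<in> carrier R"
    using t hadd_subset[OF b d(1)] by blast
  hence "t \<in> ann R a"
    using t a by (simp add: ann_def m_comm)
  hence "\<zero> \<in> b \<boxplus> d"
    using t ann by simp
  hence "\<zero> \<in> d \<boxplus> b" "\<zero> \<in> d \<boxplus> c"
    using d b c hadd_commute by auto
  thus ?thesis
    using ex1_opp[OF d(1)] b c by blast
qed

lemma (in comm_krasner_hyperring_1) pure_imp_r_hyperideal:
  assumes \<delta>: "hyperideal_expansion R \<delta>" and pure: "phi_delta_pure_hyperideal R \<phi> \<delta> N"
  shows "phi_delta_r_hyperideal R \<phi> \<delta> N"
proof -
  have N: "proper_hyperideal R N"
    using pure by (simp add: phi_delta_pure_hyperideal_def)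
  hence \<delta>N: "hyperideal R (\<delta> N)"
    using \<delta> by (simp add: proper_hyperideal_def hyperideal_expansion_def)
  have "b \<in> \<delta> N"
    if a: "a \<in> carrier R" and b: "b \<in> carrier R"
      and ab: "a \<otimes> b \<in> N - \<phi> N" and ann: "ann R a = {\<zero>}" for a b
  proof -
    obtain x where x: "x \<in> \<delta> N" "a \<otimes> b = a \<otimes> b \<otimes> x"
      using pure ab unfolding phi_delta_pure_hyperideal_def by blast
    have xR: "x \<in> carrier R"
      using x(1) \<delta>N by (auto simp: hyperideal_def)
    have "a \<otimes> b = a \<otimes> (b \<otimes> x)"
      using x(2) m_assoc[OF a b xR] by (rule trans)
    hence "b = b \<otimes> x"
      by (rule mult_left_cancel[OF a b m_closed[OF b xR] ann])
    moreover have "b \<otimes> x \<in> \<delta> N"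
      using \<delta>N b x(1) by (simp add: hyperideal_def)
    ultimately show ?thesis by simp
  qed
  thus ?thesis
    using N by (simp add: phi_delta_r_hyperideal_def)
qed

lemma (in comm_krasner_hyperring_1) von_neumann_regular_imp_pure:
  assumes \<delta>: "hyperideal_expansion R \<delta>"
    and regular: "phi_delta_von_neumann_regular_hyperideal R \<phi> \<delta> N"
  shows "phi_delta_pure_hyperideal R \<phi> \<delta> N"
proof -
  have N: "proper_hyperideal R N"
    using regular by (simp add: phi_delta_von_neumann_regular_hyperideal_def)
  hence \<delta>N: "hyperideal R (\<delta> N)"
    using \<delta> by (simp add: proper_hyperideal_def hyperideal_expansion_def)
  have "\<exists>y\<in>\<delta> N. a = a \<otimes> y" if a: "a \<in> N - \<phi> N" for a
  proof -
    obtain b where b: "b \<in> \<delta> N" "a = a [^] (2::nat) \<otimes> b"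
      using regular a unfolding phi_delta_von_neumann_regular_hyperideal_def by blast
    have aR: "a \<in> carrier R"
      using a N by (auto simp: proper_hyperideal_def hyperideal_def)
    have bR: "b \<in> carrier R"
      using b(1) \<delta>N by (auto simp: hyperideal_def)
    have "a [^] (2::nat) \<otimes> b = a \<otimes> (a \<otimes> b)"
      using aR bR by (simp add: numeral_2_eq_2 m_assoc)
    moreover have "a \<otimes> b \<in> \<delta> N"
      using \<delta>N aR b(1) by (simp add: hyperideal_def)
    ultimately show ?thesis
      using b(2) by metis
  qed
  thus ?thesis
    using N by (simp add: phi_delta_pure_hyperideal_def)
qed

theorem corollary3p13:
  fixes R :: "('a, 'm) hyperring_scheme" and \<phi> \<delta> :: "'a set \<Rightarrow> 'a set"
  assumes "comm_krasner_hyperring_1 R"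
    and "hyperideal_reduction R \<phi>"
    and "hyperideal_expansion R \<delta>"
  shows "(\<forall>N. phi_delta_pure_hyperideal R \<phi> \<delta> N \<longrightarrow> phi_delta_r_hyperideal R \<phi> \<delta> N)
    \<and> (\<forall>N. phi_delta_von_neumann_regular_hyperideal R \<phi> \<delta> N \<longrightarrow> phi_delta_r_hyperideal R \<phi> \<delta> N)"
proof -
  interpret comm_krasner_hyperring_1 R
    by (fact assms(1))
  show ?thesis
    using pure_imp_r_hyperideal[OF assms(3)] von_neumann_regular_imp_pure[OF assms(3)] by blast
qed

end
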